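(* Let $\mathbf X=(\mathbf x_1,\dots,\mathbf x_n)\in(\mathbb R^d)^n$, $1\le K\le n$, and let $\mathcal H=(H_0,\dots,H_m)$ be a nested family of simple undirected graphs on $V=[n]$, $E(H_0)\subseteq E(H_1)\subseteq\cdots\subseteq E(H_m)$, with $H_m=K_n$ the complete graph. For an edge $e$ of $K_n$ let $\iota_{\mathcal H}(e)=\min\{j:e\in E(H_j)\}$. For $A\subseteq V$ with $|A|\ge2$ let $$\kappa_{\mathcal H}(A)=\min_{T\in\mathsf{ST}(A)}\max_{e\in E(T)}\iota_{\mathcal H}(e),$$ where $\mathsf{ST}(A)$ is the set of spanning trees on vertex set $A$ (of the complete graph on $A$), and let $\kappa_{\mathcal H}(A)=0$ if $|A|=1$. For a partition $\ell$ of $V$ let $\kappa_{\mathcal H}(\ell)=\max_{A\in\ell}\kappa_{\mathcal H}(A)$. Then for every nonempty $A\subseteq V$ and every $j\in\{0,\dots,m\}$, the induced graph $H_j[A]$ is connected exactly when $j\ge\kappa_{\mathcal H}(A)$. Consequently, writing $\kappa^\star_{\mathcal H,K}(\mathbf X)=\min_{\ell\in\mathcal M_K}\kappa_{\mathcal H}(\ell)$, for every $j\in\{0,\dots,m\}$, $$\mathrm{OPT}(H_j,K)=\mathrm{OPT}_{\mathrm{unc}}(K)\iff j\ge\kappa^\star_{\mathcal H,K}(\mathbf X).$$ Thus the first covering index $j^\star(\mathbf X,K)=\min\{j:\mathrm{OPT}(H_j,K)=\mathrm{OPT}_{\mathrm{unc}}(K)\}$ equals $\kappa^\star_{\mathcal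 H,K}(\mathbf X)$.
   Context: For nonempty $A\subseteq V$, $\phi_{\mathrm{SSE}}(A)=\sum_{i\in A}\|\mathbf x_i-\boldsymbol\mu(A)\|^2$ with $\boldsymbol\mu(A)=|A|^{-1}\sum_{i\in A}\mathbf x_i$; $\mathrm{SSE}(\ell)=\sum_{A\in\ell}\phi_{\mathrm{SSE}}(A)$ for a partition $\ell$ of $V$. $\mathrm{OPT}_{\mathrm{unc}}(K)$ is the minimum of $\mathrm{SSE}(\ell)$ over all partitions of $V$ into exactly $K$ nonempty blocks, and $\mathcal M_K$ is the set of minimizers. For a graph $H$ on $V$, $\mathrm{OPT}(H,K)$ is the minimum of $\mathrm{SSE}(\ell)$ over partitions $\ell$ of $V$ into exactly $K$ nonempty blocks such that $H[A]$ is connected for each block $A$ ($\min\emptyset=+\infty$). *)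

theory Defs
  imports
    "HOL-Analysis.Analysis"
    "HOL-Library.Disjoint_Sets"
    "HOL-Library.Extended_Real"
    "Graph_Theory.Graph_Theory"
begin

text \<open>
  A simple undirected graph is a \<^locale>\<open>pair_graph\<close>: an undirected edge between \<open>u\<close> and
  \<open>v\<close> is represented by the two arcs \<open>(u, v)\<close> and \<open>(v, u)\<close>. Functions of edges, such as
  the index at which an edge enters a family of graphs, are therefore functions of arcs which take
  the same value on the two arcs of an edge.
\<close>

text \<open>The name \<open>connected\<close> is also used for topological connectedness.\<close>

abbreviation graph_connected :: "('a, 'b) pre_digraph \<Rightarrow> bool" where
  "graph_connected \<equiv> Digraph_Component.connected"

text \<open>
  \<^const>\<open>Digraph_Component.tree\<close> excludes all directed cycles, hence also the closed walk that
  goes back and forth along one edge. In a symmetric digraph without loops and parallel arcs, the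
  undirected cycles are exactly the directed cycles of length at least 3.
\<close>

definition undirected_tree :: "('a, 'b) pre_digraph \<Rightarrow> bool" where
  "undirected_tree T \<longleftrightarrow>
     graph T \<and> graph_connected T \<and> \<not> (\<exists>p. pre_digraph.cycle T p \<and> 3 \<le> length p)"

definition complete_graph_on :: "'a set \<Rightarrow> 'a pair_pre_digraph" where
  "complete_graph_on A = \<lparr> pverts = A, parcs = {(u, v). u \<in> A \<and> v \<in> A \<and> u \<noteq> v} \<rparr>"

definition spanning_trees :: "'a set \<Rightarrow> 'a pair_pre_digraph set" where
  "spanning_trees A =
     {T. undirected_tree (with_proj T) \<and> spanning (with_proj T) (with_proj (complete_graph_on A))}"

text \<open>
  A family \<open>H 0, \<dots>, H m\<close> is a function on \<^typ>\<open>nat\<close>. If \<open>H m\<close> is complete, the least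
  index below is at most \<open>m\<close> for every arc \<open>e\<close> of \<open>H m\<close>, so the values of \<open>H\<close> beyond
  \<open>m\<close> are irrelevant.
\<close>

definition edge_index :: "(nat \<Rightarrow> 'a pair_pre_digraph) \<Rightarrow> 'a \<times> 'a \<Rightarrow> nat" where
  "edge_index H e = (LEAST j. e \<in> parcs (H j))"

definition block_index :: "(nat \<Rightarrow> 'a pair_pre_digraph) \<Rightarrow> 'a set \<Rightarrow> nat" where
  "block_index H A =
     (if card A \<ge> 2
      then Min ((\<lambda>T. Max (edge_index H ` parcs T)) ` spanning_trees A)
      else 0)"

definition partition_index :: "(nat \<Rightarrow> 'a pair_pre_digraph) \<Rightarrow> 'a set set \<Rightarrow> nat" where
  "partition_index H l = Max (block_index H ` l)"

definition centroid :: "('a \<Rightarrow> real ^ 'd) \<Rightarrow> 'a set \<Rightarrow> real ^ 'd" where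
  "centroid x A = (\<Sum>i\<in>A. x i) /\<^sub>R real (card A)"

definition block_SSE :: "('a \<Rightarrow> real ^ 'd) \<Rightarrow> 'a set \<Rightarrow> real" where
  "block_SSE x A = (\<Sum>i\<in>A. (norm (x i - centroid x A))\<^sup>2)"

definition SSE :: "('a \<Rightarrow> real ^ 'd) \<Rightarrow> 'a set set \<Rightarrow> real" where
  "SSE x l = (\<Sum>A\<in>l. block_SSE x A)"

definition partitions_into :: "'a set \<Rightarrow> nat \<Rightarrow> 'a set set set" where
  "partitions_into V K = {l. partition_on V l \<and> card l = K}"

definition OPT_unc :: "('a \<Rightarrow> real ^ 'd) \<Rightarrow> 'a set \<Rightarrow> nat \<Rightarrow> real" where
  "OPT_unc x V K = Min (SSE x ` partitions_into V K)"

definition minimizers :: "('a \<Rightarrow> real ^ 'd) \<Rightarrow> 'a set \<Rightarrow> nat \<Rightarrow> 'a set set set" where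
  "minimizers x V K = {l. is_arg_min (SSE x) (\<lambda>l. l \<in> partitions_into V K) l}"

definition connected_partitions_into :: "'a pair_pre_digraph \<Rightarrow> nat \<Rightarrow> 'a set set set" where
  "connected_partitions_into G K =
     {l \<in> partitions_into (pverts G) K. \<forall>A\<in>l. graph_connected (with_proj G \<restriction> A)}"

definition OPT :: "('a \<Rightarrow> real ^ 'd) \<Rightarrow> 'a pair_pre_digraph \<Rightarrow> nat \<Rightarrow> ereal" where
  "OPT x G K =
     (if connected_partitions_into G K = {} then \<infinity>
      else ereal (Min (SSE x ` connected_partitions_into G K)))"

definition optimal_index ::
    "(nat \<Rightarrow> 'a pair_pre_digraph) \<Rightarrow> ('a \<Rightarrow> real ^ 'd) \<Rightarrow> 'a set \<Rightarrow> nat \<Rightarrow> nat" where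
  "optimal_index H x V K = Min (partition_index H ` minimizers x V K)"

definition first_covering_index ::
    "(nat \<Rightarrow> 'a pair_pre_digraph) \<Rightarrow> nat \<Rightarrow> ('a \<Rightarrow> real ^ 'd) \<Rightarrow> 'a set \<Rightarrow> nat \<Rightarrow> nat" where
  "first_covering_index H m x V K = Min {j \<in> {0..m}. OPT x (H j) K = ereal (OPT_unc x V K)}"

end

theory Submission
  imports Defs
begin

text \<open>
  A finite connected graph has a spanning tree: an edge of a cycle in a connected spanning subgraph
  can be removed without losing connectedness, so a connected spanning subgraph with the least
  number of arcs is a tree. Nestedness makes \<open>e \<in> E(H j)\<close> equivalent to \<open>\<iota>(e) \<le> j\<close>, so
  \<open>H j[A]\<close> is connected iff some spanning tree of \<open>A\<close> has all its indices at most \<open>j\<close>, that is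
  iff \<open>\<kappa>(A) \<le> j\<close>. Hence the partitions admissible for \<open>H j\<close> are the sublevel set
  \<open>\<kappa> \<le> j\<close>, and the constrained optimum agrees with the unconstrained one iff this sublevel set
  contains an unconstrained minimizer.
\<close>

section \<open>Spanning trees of connected graphs\<close>

text \<open>Connectedness is defined through the symmetric closure, which changes nothing for a
  symmetric digraph. Stated with \<open>rtrancl\<close>, it reduces edge removal to a calculation
  with relations.\<close>

lemma graph_connected_symmetric_iff:
  assumes "wf_digraph G" "symmetric G"
  shows "graph_connected G \<longleftrightarrow>
    verts G \<noteq> {} \<and> (\<forall>u\<in>verts G. \<forall>v\<in>verts G. (u, v) \<in> (arcs_ends G)\<^sup>*)"
proof -
  interpret wf_digraph G by fact
  have "graph_connected G \<longleftrightarrow> strongly_connected G"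
    using assms(2) symmetric_connected_imp_strongly_connected
    by (auto simp: connected_def strongly_connected_def reachable_mk_symmetric_eq)
  then show ?thesis
    by (auto simp: strongly_connected_def reachable_conv')
qed

lemma pcas_in_rtrancl:
  "pcas u p v \<Longrightarrow> set p \<subseteq> S \<Longrightarrow> (u, v) \<in> S\<^sup>*"
  by (induction p arbitrary: u) (auto intro: converse_rtrancl_into_rtrancl)

lemma pcas_end_in_tl_verts:
  "pcas u p v \<Longrightarrow> p \<noteq> [] \<Longrightarrow> v \<in> set (tl (pawalk_verts u p))"
proof (induction p arbitrary: u)
  case (Cons e p)
  then show ?case by (cases p) auto
qed simp

lemma arc_in_pawalk_verts:
  "pcas u p v \<Longrightarrow> (a, b) \<in> set p \<Longrightarrow> a \<in> set (pawalk_verts u p) \<and> b \<in> set (pawalk_verts u p)"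
proof (induction p arbitrary: u)
  case (Cons e p)
  then show ?case by (cases p) auto
qed simp

text \<open>The part of the cycle after its first edge leads from \<open>v\<close> back to
  \<open>u\<close>. A cycle of length at least 3 visits its vertices only once, so this part uses
  the first edge in neither direction.\<close>

lemma cycle_bypass:
  assumes cyc: "pre_digraph.cycle (with_proj G) p" and len: "3 \<le> length p"
  obtains u v where "(u, v) \<in> parcs G" "(v, u) \<in> (parcs G - {(u, v), (v, u)})\<^sup>*"
proof -
  from cyc obtain u0 where sub: "set p \<subseteq> parcs G" and cas: "pcas u0 p u0"
    and dist: "distinct (tl (pawalk_verts u0 p))"
    by (auto simp: pre_digraph.cycle_def pre_digraph.awalk_def cas_with_proj_eq
        awalk_verts_with_proj_eq)
  from len obtain e1 e2 q where p: "p = e1 # e2 # q" "q \<noteq> []"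
    by (cases p; cases "tl p"; cases "tl (tl p)") auto
  obtain v w where e: "e1 = (u0, v)" "e2 = (v, w)"
    using cas p by (cases e1; cases e2) auto
  have q: "pcas w q u0" using cas p e by auto
  have dq: "v \<notin> set (pawalk_verts w q)" "distinct (pawalk_verts w q)"
    using dist p e by auto
  have end_q: "u0 \<in> set (tl (pawalk_verts w q))"
    using pcas_end_in_tl_verts[OF q p(2)] .
  have hd_q: "pawalk_verts w q = w # tl (pawalk_verts w q)"
    using q p(2) by (cases q) auto
  \<comment> \<open>As \<open>q\<close> is nonempty, \<open>u0\<close> lies in the tail of a
    distinct list with head \<open>w\<close>. So \<open>e2\<close> is not the reversal of
    \<open>e1\<close>; the arcs of \<open>q\<close> avoid the edge because \<open>q\<close> misses
    \<open>v\<close>.\<close>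
  have "w \<noteq> u0" using end_q hd_q dq(2) by (metis distinct.simps(2))
  moreover have "w \<noteq> v" using hd_q dq(1) by (metis list.set_intros(1))
  moreover have "(u0, v) \<notin> set q" "(v, u0) \<notin> set q"
    using arc_in_pawalk_verts[OF q] dq(1) by blast+
  ultimately have "set (e2 # q) \<subseteq> parcs G - {(u0, v), (v, u0)}"
    using sub p e by auto
  moreover have "pcas v (e2 # q) u0" using q e by simp
  ultimately have "(v, u0) \<in> (parcs G - {(u0, v), (v, u0)})\<^sup>*"
    by (rule pcas_in_rtrancl[rotated])
  moreover have "(u0, v) \<in> parcs G" using sub p e by simp
  ultimately show ?thesis using that by blast
qed

text \<open>Walks can be rerouted along the bypass instead of the removed edge; by symmetry the
  bypass can also be traversed backwards.\<close>

lemma rtrancl_remove_bypassed_edge: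
  assumes "sym S" and byp: "(v, u) \<in> (S - {(u, v), (v, u)})\<^sup>*"
  shows "S\<^sup>* = (S - {(u, v), (v, u)})\<^sup>*"
proof
  let ?R = "S - {(u, v), (v, u)}"
  have "sym (?R\<^sup>*)" using \<open>sym S\<close> by (intro sym_rtrancl) (auto simp: sym_def)
  with byp have "(u, v) \<in> ?R\<^sup>*" by (auto dest: symD)
  with byp have "S \<subseteq> ?R\<^sup>*" by auto
  then show "S\<^sup>* \<subseteq> ?R\<^sup>*" by (metis rtrancl_mono rtrancl_idemp)
qed (rule rtrancl_mono, simp)

lemma connected_graph_has_spanning_tree:
  assumes G: "pair_graph G" and con: "graph_connected (with_proj G)"
  shows "\<exists>T. undirected_tree (with_proj T) \<and> spanning (with_proj T) (with_proj G)"
proof -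
  interpret G: pair_graph G by fact
  let ?P = "\<lambda>T. pair_graph T \<and> graph_connected (with_proj T) \<and>
    spanning (with_proj T) (with_proj G)"
  have "?P G" using G con by (auto simp: spanning_def G.subgraph_refl)
  then obtain T where T: "?P T" and least: "\<And>T'. ?P T' \<Longrightarrow> card (parcs T) \<le> card (parcs T')"
    using ex_has_least_nat[of ?P G "\<lambda>T. card (parcs T)"] by blast
  from T interpret T: pair_graph T by simp
  have conT: "pverts T \<noteq> {}" "\<And>u v. u \<in> pverts T \<Longrightarrow> v \<in> pverts T \<Longrightarrow> (u, v) \<in> (parcs T)\<^sup>*"
    using T graph_connected_symmetric_iff[of "with_proj T"] T.wf_digraph T.sym_arcs by auto
  have "\<not> (\<exists>p. pre_digraph.cycle (with_proj T) p \<and> 3 \<le> length p)"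
  proof
    assume "\<exists>p. pre_digraph.cycle (with_proj T) p \<and> 3 \<le> length p"
    then obtain u v where uv: "(u, v) \<in> parcs T"
      and byp: "(v, u) \<in> (parcs T - {(u, v), (v, u)})\<^sup>*"
      using cycle_bypass by metis
    \<comment> \<open>Both arcs of the edge are removed, so that the result is again
      symmetric.\<close>
    define T' where "T' = \<lparr> pverts = pverts T, parcs = parcs T - {(u, v), (v, u)} \<rparr>"
    have symT: "sym (parcs T)" using T.sym_arcs by (simp add: symmetric_def)
    have "symmetric (with_proj T')"
      using symT by (auto simp: symmetric_def T'_def sym_def)
    then interpret T': pair_graph T'
      using T.pair_finite_verts T.pair_finite_arcs T.pair_no_loops
        T.arc_fst_in_verts T.arc_snd_in_verts
      by unfold_locales (auto simp: T'_def)
    have "graph_connected (with_proj T')"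
      using conT rtrancl_remove_bypassed_edge[OF symT byp]
        graph_connected_symmetric_iff[of "with_proj T'"] T'.wf_digraph T'.sym_arcs
      by (simp add: T'_def)
    moreover have "spanning (with_proj T') (with_proj G)"
      using T T'.wf_digraph by (auto simp: spanning_def subgraph_def T'_def)
    ultimately have "card (parcs T) \<le> card (parcs T')"
      using least T'.pair_graph by blast
    moreover have "parcs T' \<subset> parcs T" using uv by (auto simp: T'_def)
    then have "card (parcs T') < card (parcs T)"
      by (rule psubset_card_mono[OF T.pair_finite_arcs])
    ultimately show False by simp
  qed
  then have "undirected_tree (with_proj T)"
    using T T.pair_graphD_graph by (simp add: undirected_tree_def)
  with T show ?thesis by blast
qed

section \<open>Spanning trees on a vertex set and induced subgraphs\<close>

text \<open>A tree on \<open>A\<close> is determined by its arcs, a subset of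
  \<open>A \<times> A\<close>. Finiteness gives the \<open>Min\<close> in \<open>block_index\<close>
  its intended meaning.\<close>

lemma finite_spanning_trees:
  assumes "finite A"
  shows "finite (spanning_trees A)"
proof (rule finite_subset)
  show "spanning_trees A \<subseteq> (\<lambda>E. \<lparr> pverts = A, parcs = E \<rparr>) ` Pow (A \<times> A)"
  proof
    fix T assume "T \<in> spanning_trees A"
    then have "pverts T = A" "parcs T \<subseteq> A \<times> A"
      by (auto simp: spanning_trees_def spanning_def subgraph_def complete_graph_on_def)
    then have "T = \<lparr> pverts = A, parcs = parcs T \<rparr>" by simp
    then show "T \<in> (\<lambda>E. \<lparr> pverts = A, parcs = E \<rparr>) ` Pow (A \<times> A)"
      using \<open>parcs T \<subseteq> A \<times> A\<close> by blast
  qed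
qed (use assms in simp)

lemma pair_graph_complete_graph_on:
  assumes "finite A"
  shows "pair_graph (complete_graph_on A)"
  using assms by unfold_locales
    (auto simp: complete_graph_on_def symmetric_def sym_def intro: finite_subset[of _ "A \<times> A"])

lemma complete_graph_on_connected:
  assumes "finite A" "A \<noteq> {}"
  shows "graph_connected (with_proj (complete_graph_on A))"
proof -
  interpret pair_graph "complete_graph_on A"
    using assms(1) by (rule pair_graph_complete_graph_on)
  have "(u, v) \<in> (parcs (complete_graph_on A))\<^sup>*" if "u \<in> A" "v \<in> A" for u v
    using that by (cases "u = v") (auto simp: complete_graph_on_def)
  then show ?thesis
    using graph_connected_symmetric_iff[OF wf_digraph sym_arcs] assms(2)
    by (simp add: complete_graph_on_def)
qed

lemma complete_graph_on_induced:
  "A \<subseteq> V \<Longrightarrow> with_proj (complete_graph_on V) \<restriction> A = with_proj (complete_graph_on A)"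
  by (auto simp: induce_subgraph_def with_proj_def complete_graph_on_def)

text \<open>This form makes results about \<open>pair_graph\<close> applicable to induced
  subgraphs.\<close>

lemma with_proj_induce_subgraph:
  "with_proj G \<restriction> A = with_proj \<lparr> pverts = A, parcs = parcs G \<inter> A \<times> A \<rparr>"
  by (auto simp: induce_subgraph_def with_proj_def)

lemma pair_graph_induced:
  assumes "pair_graph G" "finite A"
  shows "pair_graph \<lparr> pverts = A, parcs = parcs G \<inter> A \<times> A \<rparr>"
proof -
  interpret G: pair_graph G by fact
  have "sym (parcs G)" using G.sym_arcs by (simp add: symmetric_def)
  then have "sym (parcs G \<inter> A \<times> A)" by (auto simp: sym_def)
  then show ?thesis
    using assms(2) G.pair_no_loops by unfold_locales (auto simp: symmetric_def)
qed

lemma induced_connected_iff_spanning_tree: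
  assumes G: "pair_graph G" and fin: "finite A"
  shows "graph_connected (with_proj G \<restriction> A) \<longleftrightarrow> (\<exists>T\<in>spanning_trees A. parcs T \<subseteq> parcs G)"
proof -
  define GA where "GA = \<lparr> pverts = A, parcs = parcs G \<inter> A \<times> A \<rparr>"
  interpret GA: pair_graph GA
    unfolding GA_def using G fin by (rule pair_graph_induced)
  interpret K: pair_wf_digraph "complete_graph_on A"
    by unfold_locales (auto simp: complete_graph_on_def)
  \<comment> \<open>Arcs of a spanning subgraph of the complete graph stay inside \<open>A\<close>,
    so only membership in \<open>parcs G\<close> remains to be asked; conversely \<open>GA\<close>
    has no loops and lies in the complete graph.\<close>
  have eq: "spanning (with_proj T) (with_proj GA) \<longleftrightarrow>
      spanning (with_proj T) (with_proj (complete_graph_on A)) \<and> parcs T \<subseteq> parcs G" for T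
    using GA.wf_digraph GA.pair_no_loops K.wf_digraph
    by (fastforce simp: spanning_def subgraph_def complete_graph_on_def GA_def)
  have "graph_connected (with_proj GA) \<longleftrightarrow>
      (\<exists>T. undirected_tree (with_proj T) \<and> spanning (with_proj T) (with_proj GA))"
    using connected_graph_has_spanning_tree[OF GA.pair_graph]
      GA.connected_spanning_imp_connected
    by (auto simp: undirected_tree_def)
  then show ?thesis
    by (auto simp: eq spanning_trees_def with_proj_induce_subgraph GA_def[symmetric])
qed

section \<open>Indices of blocks and partitions\<close>

lemma nested_parcs_mono:
  assumes "\<And>j. j < m \<Longrightarrow> parcs (H j) \<subseteq> parcs (H (Suc j))" "i \<le> j" "j \<le> m"
  shows "parcs (H i) \<subseteq> parcs (H j)"
  using assms(2,3)
proof (induction j rule: dec_induct)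
  case (step j)
  then have "parcs (H i) \<subseteq> parcs (H j)" "parcs (H j) \<subseteq> parcs (H (Suc j))"
    using assms(1)[of j] by simp_all
  then show ?case by (rule subset_trans)
qed simp

text \<open>Membership in \<open>H m\<close> ensures that the least index is attained, and
  nestedness carries the edge from that index up to \<open>j\<close>.\<close>

lemma edge_index_le_iff:
  assumes nest: "\<And>j. j < m \<Longrightarrow> parcs (H j) \<subseteq> parcs (H (Suc j))"
    and "e \<in> parcs (H m)" "j \<le> m"
  shows "edge_index H e \<le> j \<longleftrightarrow> e \<in> parcs (H j)"
proof
  have "e \<in> parcs (H (edge_index H e))"
    unfolding edge_index_def using assms(2) by (rule LeastI)
  moreover assume "edge_index H e \<le> j"
  then have "parcs (H (edge_index H e)) \<subseteq> parcs (H j)"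
    using nested_parcs_mono[of m H, OF nest] \<open>j \<le> m\<close> by simp
  ultimately show "e \<in> parcs (H j)" by blast
qed (simp add: edge_index_def Least_le)

text \<open>Without arcs, reachability is equality, so connectedness would leave at most one vertex.
  This keeps \<open>Max\<close> away from the empty set.\<close>

lemma spanning_tree_arcs_nonempty:
  assumes T: "T \<in> spanning_trees A" and card: "2 \<le> card A"
  shows "parcs T \<noteq> {}"
proof
  assume empty: "parcs T = {}"
  have pv: "pverts T = A"
    using T by (simp add: spanning_trees_def spanning_def complete_graph_on_def)
  interpret graph "with_proj T"
    using T by (simp add: spanning_trees_def undirected_tree_def)
  have "\<forall>u\<in>A. \<forall>v\<in>A. (u, v) \<in> (parcs T)\<^sup>*"
    using T graph_connected_symmetric_iff[OF wf_digraph sym_arcs] pv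
    by (simp add: spanning_trees_def undirected_tree_def)
  then have "\<forall>u\<in>A. \<forall>v\<in>A. u = v" using empty by simp
  then have "card A \<le> 1" by (cases "finite A") (auto simp: card_le_Suc0_iff_eq)
  with card show False by simp
qed

lemma block_index_le_iff:
  fixes H :: "nat \<Rightarrow> 'a pair_pre_digraph"
  assumes nest: "\<And>j. j < m \<Longrightarrow> parcs (H j) \<subseteq> parcs (H (Suc j))"
    and G: "pair_graph (H j)" and "j \<le> m"
    and top: "H m = complete_graph_on V" and "finite V" "A \<subseteq> V" "A \<noteq> {}"
  shows "graph_connected (with_proj (H j) \<restriction> A) \<longleftrightarrow> block_index H A \<le> j"
proof (cases "2 \<le> card A")
  case True
  have fin: "finite A" using assms(5,6) by (rule finite_subset[rotated])
  have arcs: "parcs T \<subseteq> parcs (H m)" "finite (parcs T)" if "T \<in> spanning_trees A" for T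
  proof -
    have "parcs T \<subseteq> {(u, v). u \<in> A \<and> v \<in> A \<and> u \<noteq> v}"
      using that by (auto simp: spanning_trees_def spanning_def subgraph_def complete_graph_on_def)
    then show "parcs T \<subseteq> parcs (H m)" "finite (parcs T)"
      using \<open>A \<subseteq> V\<close> fin finite_subset[of "parcs T" "A \<times> A"]
      by (auto simp: top complete_graph_on_def)
  qed
  have tree_le: "Max (edge_index H ` parcs T) \<le> j \<longleftrightarrow> parcs T \<subseteq> parcs (H j)"
    if "T \<in> spanning_trees A" for T
    using arcs[OF that] spanning_tree_arcs_nonempty[OF that True]
      edge_index_le_iff[of m H, OF nest _ \<open>j \<le> m\<close>]
    by (auto simp: Max_le_iff)
  have "spanning_trees A \<noteq> {}"
    using connected_graph_has_spanning_tree[OF pair_graph_complete_graph_on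
        complete_graph_on_connected] fin \<open>A \<noteq> {}\<close>
    by (auto simp: spanning_trees_def)
  then have "block_index H A \<le> j \<longleftrightarrow>
      (\<exists>T\<in>spanning_trees A. Max (edge_index H ` parcs T) \<le> j)"
    using True finite_spanning_trees[OF fin] by (simp add: block_index_def Min_le_iff)
  then show ?thesis
    using tree_le induced_connected_iff_spanning_tree[OF G fin] by auto
next
  case False
  \<comment> \<open>On a singleton both sides hold for every \<open>j\<close>: the one-vertex graph
    is connected and \<open>block_index\<close> is 0.\<close>
  then obtain a where "A = {a}"
    using \<open>A \<noteq> {}\<close> finite_subset[OF \<open>A \<subseteq> V\<close> \<open>finite V\<close>]
    by (metis One_nat_def card_1_singletonE card_gt_0_iff leI less_2_cases_iff not_gr_zero)
  then have "graph_connected (with_proj (H j) \<restriction> A)"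
    by (auto simp: connected_conv)
  then show ?thesis using False by (simp add: block_index_def)
qed

section \<open>Optimal partitions\<close>

lemma finite_partitions_into: "finite V \<Longrightarrow> finite (partitions_into V K)"
  unfolding partitions_into_def using finitely_many_partition_on[of V]
  by (rule finite_subset[rotated]) auto

lemma partitions_into_nonempty:
  assumes "finite V" "1 \<le> K" "K \<le> card V"
  shows "partitions_into V K \<noteq> {}"
proof -
  obtain S where S: "S \<subseteq> V" "card S = K - 1"
    using obtain_subset_with_card_n[of "K - 1" V] \<open>K \<le> card V\<close>
    by (metis diff_le_self order_trans)
  have finS: "finite S" using S assms(1) finite_subset by blast
  have "V - S \<noteq> {}" using S assms card_mono[OF finS, of V] by fastforce
  \<comment> \<open>The witness consists of \<open>K - 1\<close> singletons and one block with all
    remaining points. That block contains no point of \<open>S\<close>, hence differs from each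
    singleton.\<close>
  let ?l = "insert (V - S) ((\<lambda>i. {i}) ` S)"
  have "card ?l = Suc (card ((\<lambda>i. {i}) ` S))"
    using finS by (intro card_insert_disjoint) auto
  also have "\<dots> = K" using S(2) \<open>1 \<le> K\<close> by (simp add: card_image)
  finally have "card ?l = K" .
  moreover have "partition_on V ?l"
    using \<open>V - S \<noteq> {}\<close> S(1) by (auto simp: partition_on_def disjoint_def)
  ultimately show ?thesis by (auto simp: partitions_into_def)
qed

text \<open>A positive number of blocks makes \<open>l\<close> finite and nonempty, so its
  \<open>Max\<close> is a genuine maximum.\<close>

lemma partition_index_le_iff:
  assumes "l \<in> partitions_into V K" "1 \<le> K"
  shows "partition_index H l \<le> j \<longleftrightarrow> (\<forall>A\<in>l. block_index H A \<le> j)"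
proof -
  have "finite l" "l \<noteq> {}"
    using assms by (auto simp: partitions_into_def card_eq_0_iff intro: card_ge_0_finite)
  then show ?thesis by (simp add: partition_index_def Max_le_iff)
qed

text \<open>Restricting to \<open>C\<close> can only raise the minimum. The minimum over
  \<open>C\<close> is attained, so equality holds exactly when \<open>C\<close> contains a minimizer
  over \<open>P\<close>.\<close>

lemma Min_image_subset_eq_iff:
  fixes f :: "'a \<Rightarrow> 'b::linorder"
  assumes "finite P" "C \<subseteq> P" "C \<noteq> {}"
  shows "Min (f ` C) = Min (f ` P) \<longleftrightarrow> (\<exists>l\<in>C. is_arg_min f (\<lambda>l. l \<in> P) l)"
proof -
  have fin: "finite C" "P \<noteq> {}" using assms finite_subset by auto
  have min: "is_arg_min f (\<lambda>l. l \<in> P) l \<longleftrightarrow> f l = Min (f ` P)" if "l \<in> P" for l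
    using that assms(1) eq_Min_iff[of "f ` P" "f l"] by (auto simp: is_arg_min_linorder)
  have ge: "Min (f ` P) \<le> Min (f ` C)" using assms by (intro Min_antimono) auto
  show ?thesis
  proof
    assume "Min (f ` C) = Min (f ` P)"
    moreover have "Min (f ` C) \<in> f ` C"
      using fin(1) \<open>C \<noteq> {}\<close> by (intro Min_in) simp_all
    then obtain l where "Min (f ` C) = f l" "l \<in> C" by (rule imageE)
    ultimately show "\<exists>l\<in>C. is_arg_min f (\<lambda>l. l \<in> P) l" using min assms(2) by auto
  next
    assume "\<exists>l\<in>C. is_arg_min f (\<lambda>l. l \<in> P) l"
    then obtain l where "l \<in> C" "f l = Min (f ` P)" using min assms(2) by auto
    then have "Min (f ` C) \<le> Min (f ` P)" using fin by (metis Min_le finite_imageI imageI)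
    with ge show "Min (f ` C) = Min (f ` P)" by simp
  qed
qed

lemma minimizers_nonempty:
  assumes "finite V" "1 \<le> K" "K \<le> card V"
  shows "minimizers x V K \<noteq> {}"
  using ex_is_arg_min_if_finite[OF finite_partitions_into[OF assms(1)]
      partitions_into_nonempty[OF assms], of "SSE x"]
  by (simp add: minimizers_def)

theorem proposition4:
  fixes n K m :: nat
    and x :: "nat \<Rightarrow> real ^ 'd"
    and H :: "nat \<Rightarrow> nat pair_pre_digraph"
  defines "V \<equiv> {1..n}"
  assumes "1 \<le> K" and "K \<le> n"
    and "\<And>j. j \<le> m \<Longrightarrow> pair_graph (H j)"
    and "\<And>j. j \<le> m \<Longrightarrow> pverts (H j) = V"
    and "\<And>j. j < m \<Longrightarrow> parcs (H j) \<subseteq> parcs (H (Suc j))"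
    and "H m = complete_graph_on V"
  shows "(\<forall>A j. A \<noteq> {} \<longrightarrow> A \<subseteq> V \<longrightarrow> j \<in> {0..m} \<longrightarrow>
            (graph_connected (with_proj (H j) \<restriction> A) \<longleftrightarrow> block_index H A \<le> j))
       \<and> (\<forall>j\<in>{0..m}. OPT x (H j) K = ereal (OPT_unc x V K) \<longleftrightarrow> optimal_index H x V K \<le> j)
       \<and> first_covering_index H m x V K = optimal_index H x V K"
proof -
  have finV: "finite V" and cardV: "card V = n" by (simp_all add: V_def)
  have block: "graph_connected (with_proj (H j) \<restriction> A) \<longleftrightarrow> block_index H A \<le> j"
    if "A \<noteq> {}" "A \<subseteq> V" "j \<le> m" for A j
    using block_index_le_iff[of m H j V A] assms(4,6,7) finV that by blast
  let ?P = "partitions_into V K"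
  let ?M = "minimizers x V K"
  let ?C = "\<lambda>j. connected_partitions_into (H j) K"
  have finP: "finite ?P" by (rule finite_partitions_into[OF finV])
  have M: "?M \<subseteq> ?P" "?M \<noteq> {}"
    using minimizers_nonempty[OF finV, of K x] assms(2,3) cardV
    by (auto simp: minimizers_def is_arg_min_def)
  have connected_sub: "?C j \<subseteq> ?P" if "j \<le> m" for j
    using assms(5)[OF that] by (auto simp: connected_partitions_into_def)
  have C: "?C j = {l \<in> ?P. partition_index H l \<le> j}" if "j \<le> m" for j
  proof -
    have "graph_connected (with_proj (H j) \<restriction> A) \<longleftrightarrow> block_index H A \<le> j"
      if "l \<in> ?P" "A \<in> l" for l A
      using that block[OF _ _ \<open>j \<le> m\<close>]
      by (metis (mono_tags, lifting) Sup_upper mem_Collect_eq partition_on_def partitions_into_def)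
    then have "(\<forall>A\<in>l. graph_connected (with_proj (H j) \<restriction> A)) \<longleftrightarrow> partition_index H l \<le> j"
      if "l \<in> ?P" for l
      using that partition_index_le_iff[OF that \<open>1 \<le> K\<close>] by simp
    then show ?thesis
      using assms(5)[OF that] by (auto simp only: connected_partitions_into_def)
  qed
  have idx: "optimal_index H x V K \<le> j \<longleftrightarrow> (\<exists>l\<in>?M. partition_index H l \<le> j)" for j
    using M finite_subset[OF M(1) finP] by (simp add: optimal_index_def Min_le_iff)
  have opt: "OPT x (H j) K = ereal (OPT_unc x V K) \<longleftrightarrow> optimal_index H x V K \<le> j"
    if "j \<le> m" for j
  proof (cases "?C j = {}")
    case True
    \<comment> \<open>Both sides are false: \<open>OPT\<close> is infinite while
      \<open>OPT_unc\<close> is real, and a minimizer of index at most \<open>j\<close> would be an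
      admissible partition.\<close>
    then show ?thesis using C[OF that] idx[of j] M(1) by (auto simp: OPT_def)
  next
    case False
    then have "OPT x (H j) K = ereal (OPT_unc x V K) \<longleftrightarrow>
        (\<exists>l\<in>?C j. is_arg_min (SSE x) (\<lambda>l. l \<in> ?P) l)"
      using Min_image_subset_eq_iff[OF finP _ False, of "SSE x"]
        connected_sub[OF that] by (simp add: OPT_def OPT_unc_def)
    also have "\<dots> \<longleftrightarrow> (\<exists>l\<in>?M. partition_index H l \<le> j)"
      using M(1) by (auto simp: C[OF that] minimizers_def)
    finally show ?thesis using idx by simp
  qed
  \<comment> \<open>Every block is connected in the complete graph, so every minimizer is admissible
    at \<open>m\<close>. This bounds the optimal index by \<open>m\<close> and makes the final
    interval of covering indices nonempty.\<close>
  have "?C m = ?P"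
  proof -
    have "graph_connected (with_proj (H m) \<restriction> A)" if "l \<in> ?P" "A \<in> l" for l A
    proof -
      have "A \<subseteq> V" "A \<noteq> {}"
        using that by (auto simp: partitions_into_def partition_on_def)
      then show ?thesis
        using complete_graph_on_connected[of A] finite_subset[OF _ finV]
        by (simp add: assms(7) complete_graph_on_induced)
    qed
    then show ?thesis using assms(5) by (auto simp: connected_partitions_into_def)
  qed
  then have le_m: "optimal_index H x V K \<le> m"
    using M C[of m] idx[of m] by blast
  have "{j \<in> {0..m}. OPT x (H j) K = ereal (OPT_unc x V K)} = {optimal_index H x V K..m}"
    using opt by auto
  then have "first_covering_index H m x V K = optimal_index H x V K"
    using le_m by (simp add: first_covering_index_def Min_eq_iff)
  then show ?thesis using block opt by simp
qed

end
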